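(* Let $r=r(z)$ be the power series $$r=\frac{1-z^4-z^2-\sqrt{z^8-2z^6-z^4-2z^2+1}}{2z^3}.$$ For $k\ge 0$ let $f_k(z)$ (resp. $g_k(z)$) be the generating function whose coefficient of $z^n$ is the number of partial zigzag knight's paths of size $n$ ending at height $k$ whose last step is an up-step $N$ or $E$ (resp. a down-step $\bar N$ or $\bar E$), where the empty path is counted in $f_0$. Let $F(u)=\sum_{k\ge0}u^kf_k(z)$ and $G(u)=\sum_{k\ge0}u^kg_k(z)$. Then $$F(u)=\frac{ru(u+z)}{z^2(1-ru)}+1,\qquad G(u)=\frac{r}{z^3(1-ru)}-1,\qquad F(u)+G(u)=\frac{ru^2z+ruz^2+r}{z^3(1-ru)}.$$ Moreover, $f_0=1$; $f_k=\frac{rz+1}{z^2}r^{k-1}-[k=1]\frac{1}{z^2}$ for $k\ge1$; $g_0=\frac{r}{z^3}-1$; and $g_k=\frac{r^{k+1}}{z^3}$ for $k\ge1$, where $[k=1]$ equals $1$ if $k=1$ and $0$ otherwise.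
   Context: Let $N=(1,2)$, $\bar N=(1,-2)$, $E=(2,1)$, $\bar E=(2,-1)$; $N,E$ are up-steps and $\bar N,\bar E$ are down-steps. A knight's path is a lattice path in $\mathbb N^2$ starting at $(0,0)$, ending on the $x$-axis, with steps in $\{N,\bar N,E,\bar E\}$. A zigzag knight's path is a knight's path in which consecutive steps alternate between up-steps and down-steps (two consecutive steps $(a,b),(c,d)$ satisfy $bd<0$). A partial zigzag knight's path is a prefix (possibly empty) of a zigzag knight's path. The size of a path is the abscissa of its last point; the height of a point is its ordinate. *)

theory Defs
  imports "HOL-Computational_Algebra.Computational_Algebra" "HOL-Library.Sublist"
begin

text \<open>
  A path starting at the origin is represented by its list of steps; the point reached after
  \<open>i\<close> steps is \<open>(abscissa (take i p), ordinate (take i p))\<close>.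
\<close>

definition up_steps :: "(int \<times> int) set" where
  "up_steps = {(1, 2), (2, 1)}"

definition down_steps :: "(int \<times> int) set" where
  "down_steps = {(1, -2), (2, -1)}"

definition abscissa :: "(int \<times> int) list \<Rightarrow> int" where
  "abscissa p = sum_list (map fst p)"

definition ordinate :: "(int \<times> int) list \<Rightarrow> int" where
  "ordinate p = sum_list (map snd p)"

definition knights_path :: "(int \<times> int) list \<Rightarrow> bool" where
  "knights_path p \<longleftrightarrow>
     set p \<subseteq> up_steps \<union> down_steps \<and>
     (\<forall>i\<le>length p. 0 \<le> abscissa (take i p) \<and> 0 \<le> ordinate (take i p)) \<and>
     ordinate p = 0"

definition zigzag_knights_path :: "(int \<times> int) list \<Rightarrow> bool" where
  "zigzag_knights_path p \<longleftrightarrow>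
     knights_path p \<and> successively (\<lambda>s t. snd s * snd t < 0) p"

definition partial_zigzag_knights_path :: "(int \<times> int) list \<Rightarrow> bool" where
  "partial_zigzag_knights_path p \<longleftrightarrow> (\<exists>q. zigzag_knights_path q \<and> prefix p q)"

text \<open>
  The empty path has height 0, so in \<open>f_paths\<close> it only contributes to \<open>k = n = 0\<close>.
  All these sets are finite, because every step increases the abscissa.
\<close>

definition f_paths :: "nat \<Rightarrow> nat \<Rightarrow> (int \<times> int) list set" where
  "f_paths k n = {p. partial_zigzag_knights_path p \<and> abscissa p = int n \<and> ordinate p = int k \<and>
                     (p = [] \<or> last p \<in> up_steps)}"

definition g_paths :: "nat \<Rightarrow> nat \<Rightarrow> (int \<times> int) list set" where
  "g_paths k n = {p. partial_zigzag_knights_path p \<and> abscissa p = int n \<and> ordinate p = int k \<and>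
                     p \<noteq> [] \<and> last p \<in> down_steps}"

text \<open>
  Intermediate terms such as \<open>1 / z\<^sup>2\<close> are not power series in \<open>z\<close>, and division of formal power
  series truncates, so all identities are stated in the field of Laurent series in \<open>z\<close>.
\<close>

definition f_gf :: "nat \<Rightarrow> real fls" where
  "f_gf k = fps_to_fls (Abs_fps (\<lambda>n. of_nat (card (f_paths k n))))"

definition g_gf :: "nat \<Rightarrow> real fls" where
  "g_gf k = fps_to_fls (Abs_fps (\<lambda>n. of_nat (card (g_paths k n))))"

abbreviation zL :: "real fls" where
  "zL \<equiv> fls_X"

text \<open>
  The argument of the radical has constant term 1 and \<open>root 2 1 = 1\<close>, so this is the
  square root with constant term 1.  The quotient has no pole at 0.
\<close>

definition rL :: "real fls" where
  "rL = (1 - zL ^ 4 - zL ^ 2 -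
          fps_to_fls (fps_radical root 2
            (fps_X ^ 8 - 2 * fps_X ^ 6 - fps_X ^ 4 - 2 * fps_X ^ 2 + 1)))
       / (2 * zL ^ 3)"

text \<open>
  Series in \<open>u\<close> have Laurent series in \<open>z\<close> as coefficients; \<open>zF\<close> and \<open>rF\<close> are \<open>z\<close> and \<open>r\<close> as
  constants of that ring.  The denominators \<open>zF ^ m * (1 - rF * uF)\<close> have nonzero constant term
  in \<open>u\<close>, so they are units and dividing by them is exact.
\<close>

definition F_gf :: "real fls fps" where
  "F_gf = Abs_fps f_gf"

definition G_gf :: "real fls fps" where
  "G_gf = Abs_fps g_gf"

abbreviation uF :: "real fls fps" where
  "uF \<equiv> fps_X"

abbreviation zF :: "real fls fps" where
  "zF \<equiv> fps_const zL"

abbreviation rF :: "real fls fps" where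
  "rF \<equiv> fps_const rL"

end

theory Submission
  imports Defs
begin

text \<open>
  Every nonnegative alternating path can be completed to a zigzag knight's path, so the partial
  paths are exactly the nonnegative alternating ones.  Let \<open>d\<^sub>k = g\<^sub>k + [k = 0]\<close>, which counts the
  empty path among those ending with a down-step.  Removing the last step gives
  \<open>f\<^sub>k = z d\<^sub>k\<^sub>-\<^sub>2 + z\<^sup>2 d\<^sub>k\<^sub>-\<^sub>1\<close> for \<open>k \<ge> 1\<close> (with \<open>d\<^sub>-\<^sub>1 = 0\<close>) and
  \<open>d\<^sub>k = [k = 0] + z f\<^sub>k\<^sub>+\<^sub>2 + z\<^sup>2 f\<^sub>k\<^sub>+\<^sub>1\<close>.  Eliminating \<open>f\<close>
  leaves a linear system for the \<open>d\<^sub>k\<close> all of whose coefficients are divisible by \<open>z\<close>, so it has only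
  one solution; it is \<open>d\<^sub>k = r\<^sup>k\<^sup>+\<^sup>1 / z\<^sup>3\<close>, because \<open>r = z\<^sup>2 (1 + r z) (r + z)\<close>.
\<close>

section \<open>Nonnegative alternating paths and their completion\<close>

definition nonneg_zigzag :: "(int \<times> int) list \<Rightarrow> bool" where
  "nonneg_zigzag p \<longleftrightarrow>
     set p \<subseteq> up_steps \<union> down_steps \<and> (\<forall>i\<le>length p. 0 \<le> ordinate (take i p)) \<and>
     successively (\<lambda>s t. snd s * snd t < 0) p"

lemma abscissa_Nil [simp]: "abscissa [] = 0"
  by (simp add: abscissa_def)

lemma abscissa_append [simp]: "abscissa (p @ q) = abscissa p + abscissa q"
  by (simp add: abscissa_def)

lemma abscissa_Cons [simp]: "abscissa (s # q) = fst s + abscissa q"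
  by (simp add: abscissa_def)

lemma ordinate_Nil [simp]: "ordinate [] = 0"
  by (simp add: ordinate_def)

lemma ordinate_append [simp]: "ordinate (p @ q) = ordinate p + ordinate q"
  by (simp add: ordinate_def)

lemma ordinate_Cons [simp]: "ordinate (s # q) = snd s + ordinate q"
  by (simp add: ordinate_def)

lemma nonneg_zigzag_Nil [simp]: "nonneg_zigzag []"
  by (simp add: nonneg_zigzag_def)

text \<open>Only one prefix and one adjacent pair are new, so a path can be extended or shortened
  with a local check.\<close>

lemma nonneg_zigzag_snoc:
  "nonneg_zigzag (p @ [s]) \<longleftrightarrow>
     nonneg_zigzag p \<and> s \<in> up_steps \<union> down_steps \<and> 0 \<le> ordinate p + snd s \<and>
     (p = [] \<or> snd (last p) * snd s < 0)"
  by (auto simp: nonneg_zigzag_def successively_append_iff le_Suc_eq)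

lemma nonneg_zigzag_prefix: "nonneg_zigzag (p @ q) \<Longrightarrow> nonneg_zigzag p"
  by (induction q rule: rev_induct) (auto simp: nonneg_zigzag_snoc simp flip: append_assoc)

lemma ordinate_nonneg: "nonneg_zigzag p \<Longrightarrow> 0 \<le> ordinate p"
  unfolding nonneg_zigzag_def by (drule conjunct2, drule conjunct1, drule spec[of _ "length p"]) simp

lemma last_step: "nonneg_zigzag p \<Longrightarrow> p \<noteq> [] \<Longrightarrow> last p \<in> up_steps \<union> down_steps"
  unfolding nonneg_zigzag_def using last_in_set by blast

lemma abscissa_nonneg: "set p \<subseteq> up_steps \<union> down_steps \<Longrightarrow> 0 \<le> abscissa p"
  by (induction p) (auto simp: up_steps_def down_steps_def)

lemma zigzag_knights_path_iff:
  "zigzag_knights_path p \<longleftrightarrow> nonneg_zigzag p \<and> ordinate p = 0"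
proof -
  have "0 \<le> abscissa (take i p)" if "set p \<subseteq> up_steps \<union> down_steps" for i
    using that by (intro abscissa_nonneg) (meson set_take_subset subset_trans)
  then show ?thesis
    by (auto simp: zigzag_knights_path_def knights_path_def nonneg_zigzag_def)
qed

text \<open>Alternating \<open>(1, -2)\<close> and \<open>(2, 1)\<close> lowers the height by one every two steps.\<close>

lemma completion_after_up:
  assumes "nonneg_zigzag p" "p \<noteq> []" "last p \<in> up_steps"
  shows "\<exists>q. nonneg_zigzag (p @ q) \<and> ordinate (p @ q) = 0"
  using assms
proof (induction "nat (ordinate p)" arbitrary: p rule: less_induct)
  case less
  have pos: "snd (last p) > 0"
    using less.prems by (auto simp: up_steps_def)
  consider "ordinate p = 0" | "ordinate p = 1" | "ordinate p = 2" | "ordinate p > 2"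
    using ordinate_nonneg[OF less.prems(1)] by linarith
  then show ?case
  proof cases
    case 1
    then show ?thesis using less.prems by (intro exI[of _ "[]"]) auto
  next
    case 2
    then show ?thesis using less.prems pos
      by (intro exI[of _ "[(2, -1)]"]) (auto simp: nonneg_zigzag_snoc down_steps_def)
  next
    case 3
    then show ?thesis using less.prems pos
      by (intro exI[of _ "[(1, -2)]"]) (auto simp: nonneg_zigzag_snoc down_steps_def)
  next
    case 4
    \<comment> \<open>The extended path again ends with an up-step and is lower by one, so the
      induction hypothesis applies.\<close>
    let ?p = "(p @ [(1, -2)]) @ [(2, 1)]"
    have "nonneg_zigzag ?p"
      unfolding nonneg_zigzag_snoc using less.prems pos 4
      by (auto simp: up_steps_def down_steps_def)
    then obtain q where "nonneg_zigzag (?p @ q)" "ordinate (?p @ q) = 0"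
      using less.hyps[of ?p] 4 by (auto simp: up_steps_def)
    then show ?thesis
      by (intro exI[of _ "[(1, -2), (2, 1)] @ q"]) auto
  qed
qed

text \<open>A final down-step can always be followed by \<open>(2, 1)\<close>, which reduces to a
  path ending with an up-step; the empty path is already complete.\<close>

lemma completion:
  assumes "nonneg_zigzag p"
  shows "\<exists>q. nonneg_zigzag (p @ q) \<and> ordinate (p @ q) = 0"
proof (cases "p = [] \<or> last p \<in> up_steps")
  case True
  then show ?thesis
    using completion_after_up[OF assms] by (cases "p = []") (auto intro: exI[of _ "[]"])
next
  case False
  then have "last p \<in> down_steps"
    using assms last_step[of p] by auto
  then have neg: "snd (last p) < 0"
    by (auto simp: down_steps_def)
  let ?p = "p @ [(2, 1)]"
  have "nonneg_zigzag ?p"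
    unfolding nonneg_zigzag_snoc using assms neg ordinate_nonneg[OF assms]
    by (auto simp: up_steps_def)
  then obtain q where "nonneg_zigzag (?p @ q)" "ordinate (?p @ q) = 0"
    using completion_after_up[of ?p] by (auto simp: up_steps_def)
  then show ?thesis
    by (intro exI[of _ "(2, 1) # q"]) auto
qed

lemma partial_zigzag_knights_path_iff: "partial_zigzag_knights_path p \<longleftrightarrow> nonneg_zigzag p"
  unfolding partial_zigzag_knights_path_def zigzag_knights_path_iff
  by (metis completion nonneg_zigzag_prefix prefix_def prefixI)

section \<open>Removing the last step\<close>

text \<open>
  Height and size range over the integers so that the recurrences need no case distinction for
  small values, and the empty path is put into \<open>D_paths\<close>: an up-step may follow it.
\<close>

definition U_paths :: "int \<Rightarrow> int \<Rightarrow> (int \<times> int) list set" where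
  "U_paths k n = {p. nonneg_zigzag p \<and> abscissa p = n \<and> ordinate p = k \<and> p \<noteq> [] \<and> last p \<in> up_steps}"

definition D_paths :: "int \<Rightarrow> int \<Rightarrow> (int \<times> int) list set" where
  "D_paths k n = {p. nonneg_zigzag p \<and> abscissa p = n \<and> ordinate p = k \<and> (p = [] \<or> last p \<in> down_steps)}"

lemma nonneg_zigzag_bounds: "nonneg_zigzag p \<Longrightarrow> 0 \<le> abscissa p \<and> 0 \<le> ordinate p"
  using ordinate_nonneg abscissa_nonneg by (simp add: nonneg_zigzag_def)

lemma D_paths_neg: "k < 0 \<or> n < 0 \<Longrightarrow> D_paths k n = {}"
  by (auto simp: D_paths_def dest!: nonneg_zigzag_bounds)

lemma U_paths_neg: "n < 0 \<Longrightarrow> U_paths k n = {}"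
  by (auto simp: U_paths_def dest!: nonneg_zigzag_bounds)

text \<open>An up-step starts the path or follows a down-step, and appending it never breaks
  nonnegativity.\<close>

lemma U_paths_rec:
  "U_paths k n = (\<lambda>p. p @ [(1, 2)]) ` D_paths (k - 2) (n - 1) \<union>
                 (\<lambda>p. p @ [(2, 1)]) ` D_paths (k - 1) (n - 2)" (is "_ = ?R")
proof (intro equalityI subsetI)
  fix p assume p: "p \<in> U_paths k n"
  then obtain q s where pq: "p = q @ [s]"
    by (cases p rule: rev_cases) (auto simp: U_paths_def)
  have "last q \<in> down_steps" if "q \<noteq> []"
  proof -
    have "last q \<in> up_steps \<union> down_steps"
      using p that by (intro last_step) (auto simp: pq U_paths_def nonneg_zigzag_snoc)
    with p that show ?thesis
      by (auto simp: pq U_paths_def nonneg_zigzag_snoc up_steps_def)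
  qed
  with p have "q \<in> D_paths (k - snd s) (n - fst s)" "s \<in> up_steps"
    by (auto simp: pq U_paths_def D_paths_def nonneg_zigzag_snoc)
  then show "p \<in> ?R"
    by (auto simp: pq up_steps_def)
next
  fix p assume "p \<in> ?R"
  then obtain q s where pq: "p = q @ [s]" and s: "s \<in> up_steps" and
      q: "q \<in> D_paths (k - snd s) (n - fst s)"
    by (fastforce simp: up_steps_def)
  have "0 \<le> ordinate q"
    using q by (intro ordinate_nonneg) (simp add: D_paths_def)
  moreover have "0 < snd s"
    using s by (auto simp: up_steps_def)
  moreover have "q = [] \<or> snd (last q) < 0"
    using q by (auto simp: D_paths_def down_steps_def)
  ultimately show "p \<in> U_paths k n"
    using q s by (auto simp: pq U_paths_def D_paths_def nonneg_zigzag_snoc mult_neg_pos)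
qed

text \<open>The assumption on \<open>k\<close> keeps the appended down-step above or on the axis. A
  down-step is never first, as it would go below the axis.\<close>

lemma D_paths_rec:
  assumes "0 \<le> k"
  shows "D_paths k n = (if k = 0 \<and> n = 0 then {[]} else {}) \<union>
           ((\<lambda>p. p @ [(1, -2)]) ` U_paths (k + 2) (n - 1) \<union>
            (\<lambda>p. p @ [(2, -1)]) ` U_paths (k + 1) (n - 2))" (is "_ = ?R")
proof (intro equalityI subsetI)
  fix p assume p: "p \<in> D_paths k n"
  show "p \<in> ?R"
  proof (cases p rule: rev_cases)
    case Nil
    with p show ?thesis by (auto simp: D_paths_def)
  next
    case pq: (snoc q s)
    have s: "s \<in> down_steps"
      using p by (simp add: pq D_paths_def)
    have "q \<noteq> []"
      using p s by (auto simp: pq D_paths_def nonneg_zigzag_snoc down_steps_def)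
    moreover have "last q \<in> up_steps"
    proof -
      have "last q \<in> up_steps \<union> down_steps"
        using p \<open>q \<noteq> []\<close> by (intro last_step) (auto simp: pq D_paths_def nonneg_zigzag_snoc)
      with p \<open>q \<noteq> []\<close> show ?thesis
        by (auto simp: pq D_paths_def nonneg_zigzag_snoc down_steps_def)
    qed
    ultimately have "q \<in> U_paths (k - snd s) (n - fst s)"
      using p by (auto simp: pq U_paths_def D_paths_def nonneg_zigzag_snoc)
    then show ?thesis
      using s by (auto simp: pq down_steps_def)
  qed
next
  fix p assume "p \<in> ?R"
  then show "p \<in> D_paths k n"
    using assms
    by (auto simp: U_paths_def D_paths_def nonneg_zigzag_snoc up_steps_def down_steps_def
             split: if_splits)
qed

section \<open>Finiteness and counting\<close>

text \<open>Each step advances by at least one, so fixing the size bounds the length and leaves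
  finitely many paths.\<close>

lemma length_le_abscissa: "set p \<subseteq> up_steps \<union> down_steps \<Longrightarrow> int (length p) \<le> abscissa p"
  by (induction p) (auto simp: up_steps_def down_steps_def)

lemma finite_nonneg_zigzag: "finite {p. nonneg_zigzag p \<and> abscissa p = n}"
proof (rule finite_subset)
  show "{p. nonneg_zigzag p \<and> abscissa p = n} \<subseteq>
          {p. set p \<subseteq> up_steps \<union> down_steps \<and> length p \<le> nat n}"
    using length_le_abscissa by (fastforce simp: nonneg_zigzag_def)
  show "finite {p. set p \<subseteq> up_steps \<union> down_steps \<and> length p \<le> nat n}"
    by (rule finite_lists_length_le) (simp add: up_steps_def down_steps_def)
qed

lemma finite_U_paths [simp]: "finite (U_paths k n)"
  by (rule finite_subset[OF _ finite_nonneg_zigzag[of n]]) (auto simp: U_paths_def)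

lemma finite_D_paths [simp]: "finite (D_paths k n)"
  by (rule finite_subset[OF _ finite_nonneg_zigzag[of n]]) (auto simp: D_paths_def)

lemma card_U_paths:
  "card (U_paths k n) = card (D_paths (k - 2) (n - 1)) + card (D_paths (k - 1) (n - 2))"
  by (subst U_paths_rec, subst card_Un_disjoint) (auto simp: card_image inj_on_def)

lemma card_D_paths:
  assumes "0 \<le> k"
  shows "card (D_paths k n) = of_bool (k = 0 \<and> n = 0) +
           card (U_paths (k + 2) (n - 1)) + card (U_paths (k + 1) (n - 2))"
proof -
  let ?N = "(\<lambda>p. p @ [(1, -2)]) ` U_paths (k + 2) (n - 1)"
  let ?E = "(\<lambda>p. p @ [(2, -1)]) ` U_paths (k + 1) (n - 2)"
  define R where "R = ?N \<union> ?E"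
  have "card R = card (U_paths (k + 2) (n - 1)) + card (U_paths (k + 1) (n - 2))"
    unfolding R_def by (subst card_Un_disjoint) (auto simp: card_image inj_on_def)
  moreover have "[] \<notin> R" "finite R"
    by (auto simp: R_def)
  moreover have "D_paths k n = (if k = 0 \<and> n = 0 then {[]} else {}) \<union> R"
    unfolding R_def by (rule D_paths_rec[OF assms])
  ultimately show ?thesis
    by simp
qed

section \<open>Recurrences for the generating functions\<close>

text \<open>The empty path is counted in \<open>D_gf 0\<close>, not in \<open>U_gf 0\<close>;
  \<open>f_gf 0\<close> and \<open>g_gf 0\<close> count it the other way round.\<close>

definition U_gf :: "nat \<Rightarrow> real fps" where
  "U_gf k = Abs_fps (\<lambda>n. of_nat (card (U_paths (int k) (int n))))"

definition D_gf :: "nat \<Rightarrow> real fps" where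
  "D_gf k = Abs_fps (\<lambda>n. of_nat (card (D_paths (int k) (int n))))"

lemma U_gf_0: "U_gf 0 = 0"
  by (rule fps_ext) (simp add: U_gf_def card_U_paths D_paths_neg)

text \<open>Factors \<open>fps_X\<close> and \<open>fps_X ^ 2\<close> shift coefficients by one and
  two; splitting off indices 0 and 1 avoids truncated subtraction.\<close>

lemma fps_ext_012:
  fixes a b :: "'a::zero fps"
  assumes "a $ 0 = b $ 0" "a $ 1 = b $ 1" "\<And>n. a $ (n + 2) = b $ (n + 2)"
  shows "a = b"
proof (rule fps_ext)
  fix n :: nat
  have "n = 0 \<or> n = 1 \<or> n = n - 2 + 2"
    by linarith
  then show "a $ n = b $ n"
    using assms by metis
qed

text \<open>Height 1 is reached by an up-step only through \<open>(2, 1)\<close> from the axis,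
  since \<open>(1, 2)\<close> would have to start at height -1.\<close>

lemma U_gf_1: "U_gf 1 = fps_X ^ 2 * D_gf 0"
  by (rule fps_ext_012)
     (simp_all add: U_gf_def D_gf_def card_U_paths[of 1] D_paths_neg fps_X_power_mult_nth)

lemma U_gf_Suc_Suc: "U_gf (k + 2) = fps_X * D_gf k + fps_X ^ 2 * D_gf (k + 1)"
  by (rule fps_ext_012)
     (simp_all add: U_gf_def D_gf_def card_U_paths[of "int k + 2"] D_paths_neg fps_X_power_mult_nth
                    algebra_simps)

lemma D_gf_rec: "D_gf k = of_bool (k = 0) + fps_X * U_gf (k + 2) + fps_X ^ 2 * U_gf (k + 1)"
  by (rule fps_ext_012)
     (simp_all add: U_gf_def D_gf_def card_D_paths[of "int k"] U_paths_neg fps_X_power_mult_nth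
                    algebra_simps)

text \<open>The system refers to index \<open>k + 1\<close>, so induction on \<open>k\<close> fails.
  The leading factor \<open>fps_X\<close> makes coefficient \<open>n\<close> depend only on lower
  coefficients, which permits induction on \<open>n\<close> for all \<open>k\<close> at
  once.\<close>

lemma linear_system_unique:
  fixes a b :: "nat \<Rightarrow> real fps"
  assumes a: "\<And>k. a k = c k + fps_X * (p * a k + q * a (k + 1) + q * (if k = 0 then 0 else a (k - 1)))"
    and b: "\<And>k. b k = c k + fps_X * (p * b k + q * b (k + 1) + q * (if k = 0 then 0 else b (k - 1)))"
  shows "a k = b k"
proof -
  have "\<forall>k. a k $ n = b k $ n" for n
  proof (induction n rule: less_induct)
    case (less n)
    have *: "(w * a j) $ m = (w * b j) $ m" if "m < n" for w m j
      using less that by (auto simp: fps_mult_nth intro!: sum.cong)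
    show ?case
    proof
      fix k
      show "a k $ n = b k $ n"
        by (subst a, subst b) (cases n; simp add: *)
    qed
  qed
  then show ?thesis by (simp add: fps_eq_iff)
qed

section \<open>The algebraic series r and the solution of the system\<close>

text \<open>
  This is \<open>r / z\<^sup>3\<close>.  Multiplying the quotient defining \<open>r\<close> by the conjugate of its numerator, the
  numerator becomes \<open>4 z\<^sup>6\<close>, which shows that \<open>r / z\<^sup>3\<close> is a power series.
\<close>

definition S_fps :: "real fps" where
  "S_fps = 2 / (1 - fps_X ^ 4 - fps_X ^ 2 +
     fps_radical root 2 (fps_X ^ 8 - 2 * fps_X ^ 6 - fps_X ^ 4 - 2 * fps_X ^ 2 + 1))"

lemma fps_radical_root_2_square:
  assumes "a $ 0 = (1 :: real)"
  shows "fps_radical root 2 a ^ 2 = a"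
  using power_radical[of a root 1] assms by (simp add: numeral_2_eq_2)

lemma S_fps_props:
  shows rL_eq: "rL = zL ^ 3 * fps_to_fls S_fps"
    and S_fps_eq: "S_fps = 1 + (fps_X ^ 4 + fps_X ^ 2) * S_fps + fps_X ^ 6 * S_fps ^ 2"
proof -
  define Q :: "real fps" where "Q = fps_X ^ 8 - 2 * fps_X ^ 6 - fps_X ^ 4 - 2 * fps_X ^ 2 + 1"
  define s where "s = fps_radical root 2 Q"
  define B :: "real fps" where "B = 1 - fps_X ^ 4 - fps_X ^ 2"
  have Q0: "Q $ 0 = 1" by (simp add: Q_def)
  have s2: "s ^ 2 = Q" unfolding s_def using Q0 by (rule fps_radical_root_2_square)
  \<comment> \<open>The chosen root has constant term 1, so \<open>B + s\<close> is a unit and the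
    division in \<open>S_fps\<close> is exact.\<close>
  have "(B + s) $ 0 = 2" by (simp add: B_def s_def Q0)
  then have unit: "is_unit (B + s)" and "B + s \<noteq> 0"
    by (simp, metis fps_zero_nth zero_neq_numeral)
  have S: "S_fps * (B + s) = 2"
    using unit by (simp add: S_fps_def B_def s_def Q_def dvd_div_mult_self unit_imp_dvd)
  have prod: "(B - s) * (B + s) = 4 * fps_X ^ 6"
  proof -
    have "(B - s) * (B + s) = B ^ 2 - Q" by (simp add: s2[symmetric] algebra_simps power2_eq_square)
    also have "\<dots> = 4 * fps_X ^ 6" unfolding B_def Q_def by algebra
    finally show ?thesis .
  qed
  have diff: "B - s = 2 * fps_X ^ 6 * S_fps"
  proof -
    have "(B - s) * (B + s) = (2 * fps_X ^ 6 * S_fps) * (B + s)"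
      using prod S by algebra
    then show ?thesis using \<open>B + s \<noteq> 0\<close> by simp
  qed
  \<comment> \<open>Adding \<open>S_fps * (B + s) = 2\<close> and
    \<open>S_fps * (B - s) = 2 * fps_X ^ 6 * S_fps ^ 2\<close> eliminates the square root.\<close>
  have "2 * (B * S_fps - fps_X ^ 6 * S_fps ^ 2) = 2 * 1"
  proof -
    have "2 * (B * S_fps - fps_X ^ 6 * S_fps ^ 2) =
        S_fps * (B + s) + S_fps * ((B - s) - 2 * fps_X ^ 6 * S_fps)"
      by (simp add: algebra_simps power2_eq_square)
    then show ?thesis by (simp add: S diff)
  qed
  then have "B * S_fps - fps_X ^ 6 * S_fps ^ 2 = 1"
    by (simp only: mult_cancel_left) simp
  then show "S_fps = 1 + (fps_X ^ 4 + fps_X ^ 2) * S_fps + fps_X ^ 6 * S_fps ^ 2"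
    unfolding B_def by algebra
  have field: "2 * z ^ 6 * S / (2 * z ^ 3) = z ^ 3 * S" if "z \<noteq> 0" for z S :: "real fls"
    using that by (simp add: field_simps flip: power_add)
  have "rL = fps_to_fls (B - s) / (2 * zL ^ 3)"
    by (simp add: rL_def B_def s_def Q_def fls_times_fps_to_fls fps_to_fls_power)
  also have "\<dots> = 2 * zL ^ 6 * fps_to_fls S_fps / (2 * zL ^ 3)"
    by (simp add: diff fls_times_fps_to_fls fps_to_fls_power)
  also have "\<dots> = zL ^ 3 * fps_to_fls S_fps"
    by (rule field) simp
  finally show "rL = zL ^ 3 * fps_to_fls S_fps" .
qed

text \<open>Both sides solve one system, obtained by appending an up-step and a down-step: the
  height is kept with size 2 or 4, or changes by one either way with size 3. Taking out one factor
  \<open>fps_X\<close> gives \<open>p\<close> and \<open>q\<close>.\<close>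

lemma D_gf_eq: "D_gf k = S_fps * (fps_X ^ 3 * S_fps) ^ k"
proof (rule linear_system_unique[where c = "\<lambda>k. of_bool (k = 0)" and p = "fps_X ^ 3 + fps_X" and q = "fps_X ^ 2"])
  fix k
  show "D_gf k = of_bool (k = 0) + fps_X * ((fps_X ^ 3 + fps_X) * D_gf k + fps_X ^ 2 * D_gf (k + 1) +
      fps_X ^ 2 * (if k = 0 then 0 else D_gf (k - 1)))"
  proof (cases k)
    case 0
    have "D_gf 0 = 1 + fps_X * U_gf 2 + fps_X ^ 2 * U_gf 1"
      using D_gf_rec[of 0] by (simp only: add_0 of_bool_eq refl)
    moreover have "U_gf 2 = fps_X * D_gf 0 + fps_X ^ 2 * D_gf 1"
      using U_gf_Suc_Suc[of 0] by (simp only: add_0)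
    ultimately have "D_gf 0 = 1 + fps_X * ((fps_X ^ 3 + fps_X) * D_gf 0 + fps_X ^ 2 * D_gf 1)"
      using U_gf_1 by algebra
    then show ?thesis by (simp add: 0)
  next
    case (Suc j)
    have "D_gf k = fps_X * U_gf (k + 2) + fps_X ^ 2 * U_gf (j + 2)"
      using D_gf_rec[of k] by (simp add: Suc)
    moreover have "U_gf (j + 2) = fps_X * D_gf j + fps_X ^ 2 * D_gf k"
      using U_gf_Suc_Suc[of j] by (simp add: Suc)
    ultimately have "D_gf k = fps_X * ((fps_X ^ 3 + fps_X) * D_gf k + fps_X ^ 2 * D_gf (k + 1) +
        fps_X ^ 2 * D_gf j)"
      using U_gf_Suc_Suc[of k] by algebra
    then show ?thesis by (simp add: Suc)
  qed
next
  fix k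
  let ?d = "\<lambda>k. S_fps * (fps_X ^ 3 * S_fps) ^ k"
  show "?d k = of_bool (k = 0) + fps_X * ((fps_X ^ 3 + fps_X) * ?d k + fps_X ^ 2 * ?d (k + 1) +
      fps_X ^ 2 * (if k = 0 then 0 else ?d (k - 1)))"
  proof (cases k)
    case 0
    have "S_fps = 1 + fps_X * ((fps_X ^ 3 + fps_X) * S_fps + fps_X ^ 2 * (S_fps * (fps_X ^ 3 * S_fps)))"
      using S_fps_eq by algebra
    then show ?thesis by (simp add: 0)
  next
    case (Suc j)
    \<comment> \<open>\<open>T\<close> is r as a power series; its quadratic equation times
      \<open>S_fps * T ^ j\<close> is the required recurrence.\<close>
    define T where "T = fps_X ^ 3 * S_fps"
    have T: "T = fps_X * ((fps_X ^ 3 + fps_X) * T + fps_X ^ 2 * T ^ 2 + fps_X ^ 2)"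
      unfolding T_def using S_fps_eq by algebra
    have "S_fps * T ^ k = S_fps * T ^ j * T"
      by (simp add: Suc)
    also have "\<dots> = S_fps * T ^ j * (fps_X * ((fps_X ^ 3 + fps_X) * T + fps_X ^ 2 * T ^ 2 + fps_X ^ 2))"
      using T by (rule arg_cong)
    also have "\<dots> = of_bool (k = 0) + fps_X * ((fps_X ^ 3 + fps_X) * (S_fps * T ^ k) +
        fps_X ^ 2 * (S_fps * T ^ (k + 1)) + fps_X ^ 2 * (if k = 0 then 0 else S_fps * T ^ (k - 1)))"
      by (simp add: Suc algebra_simps power2_eq_square)
    finally show ?thesis
      unfolding T_def .
  qed
qed

section \<open>Closed forms at each height\<close>

lemma f_gf_eq: "f_gf k = of_bool (k = 0) + fps_to_fls (U_gf k)"
proof -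
  have "f_paths k n = (if k = 0 \<and> n = 0 then {[]} else {}) \<union> U_paths (int k) (int n)" for n
    by (auto simp: f_paths_def U_paths_def partial_zigzag_knights_path_iff)
  then have "card (f_paths k n) = of_bool (k = 0 \<and> n = 0) + card (U_paths (int k) (int n))" for n
    by (subst \<open>f_paths k n = _\<close>, subst card_Un_disjoint) (auto simp: U_paths_def[of 0 0])
  then have "Abs_fps (\<lambda>n. of_nat (card (f_paths k n))) = of_bool (k = 0) + U_gf k"
    by (intro fps_ext) (auto simp: U_gf_def)
  then show ?thesis by (simp add: f_gf_def)
qed

lemma g_gf_eq: "g_gf k = fps_to_fls (D_gf k) - of_bool (k = 0)"
proof -
  have "D_paths (int k) (int n) = (if k = 0 \<and> n = 0 then {[]} else {}) \<union> g_paths k n" for n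
    by (auto simp: g_paths_def D_paths_def partial_zigzag_knights_path_iff)
  moreover from this have "finite (g_paths k n)" for n
    using finite_D_paths[of "int k" "int n"] by (metis finite_Un)
  ultimately have "card (D_paths (int k) (int n)) = of_bool (k = 0 \<and> n = 0) + card (g_paths k n)" for n
    by (subst \<open>\<And>n. D_paths (int k) (int n) = _\<close>, subst card_Un_disjoint) (auto simp: g_paths_def[of 0 0])
  then have "D_gf k = of_bool (k = 0) + Abs_fps (\<lambda>n. of_nat (card (g_paths k n)))"
    by (intro fps_ext) (auto simp: D_gf_def)
  then show ?thesis by (simp add: g_gf_def)
qed

lemma D_gf_fls: "fps_to_fls (D_gf k) = rL ^ (k + 1) / zL ^ 3"
proof (rule eq_divide_imp)
  show "fps_to_fls (D_gf k) * zL ^ 3 = rL ^ (k + 1)"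
    by (simp add: D_gf_eq rL_eq fls_times_fps_to_fls fps_to_fls_power)
qed simp

lemma f_gf_0: "f_gf 0 = 1"
  by (simp add: f_gf_eq U_gf_0)

lemma f_gf_1: "f_gf 1 = rL / zL"
proof (rule eq_divide_imp)
  have "fps_to_fls (D_gf 0) * zL ^ 3 = rL"
    unfolding D_gf_fls by (simp del: fls_divide_X_power)
  then show "f_gf 1 * zL = rL"
    unfolding f_gf_eq U_gf_1
    by (simp add: fls_times_fps_to_fls fps_to_fls_power power2_eq_square power3_eq_cube ac_simps)
qed simp

lemma f_gf_Suc_Suc: "f_gf (k + 2) = (rL * zL + 1) / zL ^ 2 * rL ^ (k + 1)"
proof -
  have field: "z * (r ^ (k + 1) / z ^ 3) + z ^ 2 * (r ^ (k + 1 + 1) / z ^ 3) =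
      (r * z + 1) / z ^ 2 * r ^ (k + 1)" if "z \<noteq> 0" for r z :: "real fls"
    using that by (simp add: field_simps power2_eq_square power3_eq_cube)
  have "f_gf (k + 2) = zL * fps_to_fls (D_gf k) + zL ^ 2 * fps_to_fls (D_gf (k + 1))"
    unfolding f_gf_eq U_gf_Suc_Suc by (simp add: fls_times_fps_to_fls fps_to_fls_power)
  also have "\<dots> = (rL * zL + 1) / zL ^ 2 * rL ^ (k + 1)"
    unfolding D_gf_fls by (rule field) simp
  finally show ?thesis .
qed

lemma g_gf_closed: "g_gf k = rL ^ (k + 1) / zL ^ 3 - of_bool (k = 0)"
  by (simp only: g_gf_eq D_gf_fls)

text \<open>At \<open>k = 1\<close> the general formula would include a step \<open>(1, 2)\<close>
  from height -1, contributing \<open>zL * (1 / zL ^ 3) = 1 / zL ^ 2\<close>; the correction removes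
  it.\<close>

lemma f_gf_closed:
  assumes "1 \<le> k"
  shows "f_gf k = (rL * zL + 1) / zL ^ 2 * rL ^ (k - 1) - of_bool (k = 1) * (1 / zL ^ 2)"
proof (cases "k = 1")
  case True
  have field: "r / z = (r * z + 1) / z ^ 2 - 1 / z ^ 2" if "z \<noteq> 0" for r z :: "real fls"
    using that by (simp add: add_divide_distrib power2_eq_square)
  show ?thesis
    unfolding True f_gf_1 using field[of zL rL] by (simp del: fls_divide_X fls_divide_X_power)
next
  case False
  then obtain j where j: "k = j + 2"
    using assms le_Suc_ex[of 2 k] by force
  show ?thesis
    unfolding j f_gf_Suc_Suc by simp
qed

section \<open>Bivariate generating functions\<close>

text \<open>From height 2 on, \<open>f_gf\<close> is geometric with ratio \<open>rL\<close>, so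
  coefficients from \<open>k = 3\<close> on cancel; the first three produce the right-hand
  side.\<close>

lemma F_gf_mult: "(F_gf - 1) * (zF ^ 2 * (1 - rF * uF)) = rF * uF * (uF + zF)"
proof (rule fps_ext)
  fix k
  have eq: "(F_gf - 1) * (zF ^ 2 * (1 - rF * uF)) =
      fps_const (zL ^ 2) * (F_gf - 1) - fps_const (zL ^ 2 * rL) * (uF * (F_gf - 1))"
    unfolding fps_const_mult[symmetric] fps_const_power[symmetric] by algebra
  have eq': "rF * uF * (uF + zF) = fps_const rL * uF ^ 2 + fps_const (rL * zL) * uF"
    unfolding fps_const_mult[symmetric] by algebra
  have f1: "zL ^ 2 * f_gf (Suc 0) = rL * zL"
    using f_gf_1 by (simp add: power2_eq_square del: fls_divide_X)
  have f2: "zL ^ 2 * f_gf (Suc (Suc j)) = (rL * zL + 1) * rL ^ (j + 1)" for j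
    using f_gf_Suc_Suc[of j] by (simp del: fls_divide_X_power)
  consider "k = 0" | "k = 1" | "k = 2" | j where "k = Suc (Suc (Suc j))"
    by (metis One_nat_def Suc_1 not0_implies_Suc)
  then show "((F_gf - 1) * (zF ^ 2 * (1 - rF * uF))) $ k = (rF * uF * (uF + zF)) $ k"
  proof cases
    case 1
    then show ?thesis unfolding eq eq' by (simp add: F_gf_def f_gf_0)
  next
    case 2
    then show ?thesis unfolding eq eq' by (simp add: F_gf_def f_gf_0 f1)
  next
    case 3
    have "zL ^ 2 * f_gf (Suc (Suc 0)) - rL * (zL ^ 2 * f_gf (Suc 0)) = rL"
      unfolding f1 f2 by (simp add: algebra_simps)
    with 3 show ?thesis unfolding eq eq' by (simp add: F_gf_def numeral_2_eq_2 mult_ac)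
  next
    case (4 j)
    have "zL ^ 2 * f_gf (Suc (Suc (Suc j))) - rL * (zL ^ 2 * f_gf (Suc (Suc j))) = 0"
      unfolding f2 by (simp add: algebra_simps)
    with 4 show ?thesis unfolding eq eq' by (simp add: F_gf_def fps_X_power_nth mult_ac)
  qed
qed

text \<open>Adding 1 makes the coefficients geometric with ratio \<open>rL\<close> from
  \<open>k = 0\<close> on, so only the constant term survives.\<close>

lemma G_gf_mult: "(G_gf + 1) * (zF ^ 3 * (1 - rF * uF)) = rF"
proof (rule fps_ext)
  fix k
  have eq: "(G_gf + 1) * (zF ^ 3 * (1 - rF * uF)) =
      fps_const (zL ^ 3) * (G_gf + 1) - fps_const (zL ^ 3 * rL) * (uF * (G_gf + 1))"
    unfolding fps_const_mult[symmetric] fps_const_power[symmetric] by algebra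
  have zg: "zL ^ 3 * (g_gf j + of_bool (j = 0)) = rL ^ (j + 1)" for j
    unfolding g_gf_closed by (simp del: fls_divide_X_power)
  show "((G_gf + 1) * (zF ^ 3 * (1 - rF * uF))) $ k = rF $ k"
  proof (cases k)
    case 0
    then show ?thesis
      unfolding eq using zg[of 0] by (simp add: G_gf_def)
  next
    case (Suc j)
    have "zL ^ 3 * (g_gf (Suc j) + of_bool (Suc j = 0)) - rL * (zL ^ 3 * (g_gf j + of_bool (j = 0))) = 0"
      unfolding zg by simp
    with Suc show ?thesis
      unfolding eq by (simp add: G_gf_def mult_ac)
  qed
qed

theorem theorem1:
  "F_gf = rF * uF * (uF + zF) / (zF ^ 2 * (1 - rF * uF)) + 1 \<and>
   G_gf = rF / (zF ^ 3 * (1 - rF * uF)) - 1 \<and>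
   F_gf + G_gf = (rF * uF ^ 2 * zF + rF * uF * zF ^ 2 + rF) / (zF ^ 3 * (1 - rF * uF)) \<and>
   f_gf 0 = 1 \<and>
   (\<forall>k\<ge>1. f_gf k = (rL * zL + 1) / zL ^ 2 * rL ^ (k - 1) - of_bool (k = 1) * (1 / zL ^ 2)) \<and>
   g_gf 0 = rL / zL ^ 3 - 1 \<and>
   (\<forall>k\<ge>1. g_gf k = rL ^ (k + 1) / zL ^ 3)"
proof -
  have "(1 - rF * uF) $ 0 \<noteq> 0" by simp
  then have "1 - rF * uF \<noteq> 0" by (metis fps_zero_nth)
  then have nz: "zF ^ m * (1 - rF * uF) \<noteq> 0" for m
    by simp
  have div: "x = y / w" if "x * w = y" "w \<noteq> 0" for x y w :: "real fls fps"
    unfolding that(1)[symmetric] using that(2) by (rule nonzero_mult_div_cancel_right[symmetric])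
  have F: "F_gf - 1 = rF * uF * (uF + zF) / (zF ^ 2 * (1 - rF * uF))"
    by (rule div[OF F_gf_mult nz])
  have G: "G_gf + 1 = rF / (zF ^ 3 * (1 - rF * uF))"
    by (rule div[OF G_gf_mult nz])
  have FG: "F_gf + G_gf =
      (rF * uF ^ 2 * zF + rF * uF * zF ^ 2 + rF) / (zF ^ 3 * (1 - rF * uF))"
  proof (rule div[OF _ nz])
    \<comment> \<open>The constants in \<open>F_gf - 1\<close> and \<open>G_gf + 1\<close> cancel,
      and a factor \<open>zF\<close> brings the first to the common denominator.\<close>
    have "(F_gf + G_gf) * (zF ^ 3 * (1 - rF * uF)) =
        zF * ((F_gf - 1) * (zF ^ 2 * (1 - rF * uF))) + (G_gf + 1) * (zF ^ 3 * (1 - rF * uF))"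
      by algebra
    also have "\<dots> = rF * uF ^ 2 * zF + rF * uF * zF ^ 2 + rF"
      unfolding F_gf_mult G_gf_mult by algebra
    finally show "(F_gf + G_gf) * (zF ^ 3 * (1 - rF * uF)) =
        rF * uF ^ 2 * zF + rF * uF * zF ^ 2 + rF" .
  qed
  have g0: "g_gf 0 = rL / zL ^ 3 - 1" and gk: "\<forall>k\<ge>1. g_gf k = rL ^ (k + 1) / zL ^ 3"
    unfolding g_gf_closed by auto
  show ?thesis
    unfolding F[symmetric] G[symmetric]
    using FG f_gf_0 f_gf_closed g0 gk by (intro conjI allI impI) (simp_all only: diff_add_cancel add_diff_cancel)
qed

end
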